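(* Let $n\ge 2$ and $k\ge 2$ be integers. The maximum of the genus $g(Q)$ over all Jenga-like configurations $Q$ of the $(n,k)$-game equals $$ g(n,k)=\begin{cases}\dfrac{n(n-2)(k-2)}{2} & \text{if } n \text{ is even},\\[2mm] \dfrac{n(n-1)(k-2)}{2} & \text{if } n \text{ is odd}.\end{cases} $$ That is, every Jenga-like configuration $Q$ satisfies $g(Q)\le g(n,k)$, and some Jenga-like configuration (the $(n,k)$-configuration) has genus exactly $g(n,k)$.
   Context: The $(n,k)$-Jenga game ($(n,k)$-game) is played with $nk$ congruent blocks, each a box of length $n$, width $1$ and height $1$. Positions are organised in levels $1,2,3,\dots$ from the ground up; level $i$ occupies heights $[i-1,i]$ and has $n$ slots $j=1,\dots,n$. A block in slot $j$ of an odd level $i$ is the box $[0,n]\times[j-1,j]\times[i-1,i]$, and a block in slot $j$ of an even level $i$ is the box $[j-1,j]\times[0,n]\times[i-1,i]$ (consecutive levels are rotated by $90^\circ$). The initial configuration has $k$ levels, each with all $n$ slots filled. A move consists of removing exactly one block from some level, which is not the topmost level and, when the topmost level is incomplete (has fewer than $n$ blocks), is not the level immediately below the topmost level, and placing it in an empty slot of the topmost level if that level is incomplete, or in a slot of a new level on top if the topmost level is complete. A Jenga-like configuration is any configuration obtainable from the initial one by finitely many moves in which every level up to the topmost contains at least one block (physical stability is otherwise disregarded). For such a configuration $Q$, the boundary of the union of its blocks is a connected closed polyhedral surface in $\mathbb R^3$ (each edge lies in exactly two faces and the link of each vertex is connected); $g(Q)$ denotes its genus. *)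

theory Defs
  imports Main
begin

text \<open>A configuration is a list of levels (index 0 = level 1); each level is the
set of occupied slots, a subset of {1..n}.\<close>

type_synonym config = "nat set list"

definition initial_config :: "nat \<Rightarrow> nat \<Rightarrow> config" where
  "initial_config n k = replicate k {1..n}"

definition jmove :: "nat \<Rightarrow> config \<Rightarrow> config \<Rightarrow> bool" where
  "jmove n Q Q' \<longleftrightarrow> Q \<noteq> [] \<and>
     (\<exists>l j. l + 1 < length Q \<and>
        (card (last Q) < n \<longrightarrow> l + 2 < length Q) \<and>
        j \<in> Q ! l \<and>
        (if card (last Q) < n
         then (\<exists>s \<in> {1..n} - last Q.
                 Q' = (Q[l := Q ! l - {j}])[length Q - 1 := insert s (last Q)])
         else (\<exists>s \<in> {1..n}. Q' = Q[l := Q ! l - {j}] @ [{s}])))"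

definition jenga_like :: "nat \<Rightarrow> nat \<Rightarrow> config \<Rightarrow> bool" where
  "jenga_like n k Q \<longleftrightarrow> (jmove n)\<^sup>*\<^sup>* (initial_config n k) Q \<and>
     (\<forall>i < length Q. Q ! i \<noteq> {})"

type_synonym pt = "int \<times> int \<times> int"

text \<open>Unit cubes [x,x+1]x[y,y+1]x[z,z+1] (indexed by their lower corner) making up
the union of the blocks of Q. Level i+1 (0-based index i) occupies z = i; odd
levels (even i) run along the x-axis, even levels along the y-axis.\<close>

definition cubes :: "nat \<Rightarrow> config \<Rightarrow> pt set" where
  "cubes n Q = {(x, y, z). \<exists>i < length Q. z = int i \<and> (\<exists>j \<in> Q ! i.
      (if even i then 0 \<le> x \<and> x < int n \<and> y = int j - 1
                 else x = int j - 1 \<and> 0 \<le> y \<and> y < int n))}"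

fun unit_vec :: "nat \<Rightarrow> pt" where
  "unit_vec d = (if d = 0 then (1,0,0) else if d = 1 then (0,1,0) else (0,0,1))"

definition padd :: "pt \<Rightarrow> pt \<Rightarrow> pt" where
  "padd p q = (fst p + fst q, fst (snd p) + fst (snd q), snd (snd p) + snd (snd q))"

definition psub :: "pt \<Rightarrow> pt \<Rightarrow> pt" where
  "psub p q = (fst p - fst q, fst (snd p) - fst (snd q), snd (snd p) - snd (snd q))"

text \<open>Grid cells: a unit square (d,p) is p + the unit square spanned by the two axes
other than d; a unit edge (d,p) is the segment from p to p + unit_vec d.
A unit square is on the boundary iff exactly one of the two adjacent cubes is
in the union.\<close>

definition bdry_faces :: "nat \<Rightarrow> config \<Rightarrow> (nat \<times> pt) set" where
  "bdry_faces n Q = {(d, p). d < 3 \<and>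
      ((p \<in> cubes n Q) \<noteq> (psub p (unit_vec d) \<in> cubes n Q))}"

definition face_edges :: "nat \<Rightarrow> pt \<Rightarrow> (nat \<times> pt) set" where
  "face_edges d p = (let a = (d + 1) mod 3; b = (d + 2) mod 3 in
     {(a, p), (a, padd p (unit_vec b)), (b, p), (b, padd p (unit_vec a))})"

definition face_verts :: "nat \<Rightarrow> pt \<Rightarrow> pt set" where
  "face_verts d p = (let a = (d + 1) mod 3; b = (d + 2) mod 3 in
     {p, padd p (unit_vec a), padd p (unit_vec b),
      padd (padd p (unit_vec a)) (unit_vec b)})"

definition bdry_edges :: "nat \<Rightarrow> config \<Rightarrow> (nat \<times> pt) set" where
  "bdry_edges n Q = (\<Union>(d, p) \<in> bdry_faces n Q. face_edges d p)"

definition bdry_verts :: "nat \<Rightarrow> config \<Rightarrow> pt set" where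
  "bdry_verts n Q = (\<Union>(d, p) \<in> bdry_faces n Q. face_verts d p)"

definition euler_char :: "nat \<Rightarrow> config \<Rightarrow> int" where
  "euler_char n Q = int (card (bdry_verts n Q)) - int (card (bdry_edges n Q))
                    + int (card (bdry_faces n Q))"

definition genus :: "nat \<Rightarrow> config \<Rightarrow> int" where
  "genus n Q = (2 - euler_char n Q) div 2"

definition gmax :: "nat \<Rightarrow> nat \<Rightarrow> int" where
  "gmax n k = (if even n then int n * (int n - 2) * (int k - 2) div 2
               else int n * (int n - 1) * (int k - 2) div 2)"

end

theory Submission
  imports Defs
begin

text \<open>Idea. The boundary is counted layer by layer: a horizontal plane contributes
r + r' - 2rr' to the Euler characteristic, where r and r' are the numbers of runs of adjacent blocks
in the levels below and above it, and the open slab between two planes contributes 0. Hence the genus is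
the sum of r(i)(r(i+1) - 1) over consecutive levels, up to a correction at the top.
At any time the level just below the top is full, and at least 2n blocks lie in the top three levels
(for three or more levels), so the levels i with a nonzero term contain at most n(k - 2) blocks in total.
Since r(i) is at most the number of blocks and r(i+1) is at most R, the ceiling of n/2, the
genus is at most n(k - 2)(R - 1). Thinning the levels from the bottom up to every
other slot attains the bound.\<close>

section \<open>Runs of adjacent integers\<close>

text \<open>Read \<open>S\<close> as a union of unit intervals from \<open>p\<close> to
  \<open>p + 1\<close>: \<open>cl S\<close> is the set of its integer points, \<open>it S\<close>
  the set of those in its interior.\<close>

definition cl :: "int set \<Rightarrow> int set" where "cl S = {p. p \<in> S \<or> p - 1 \<in> S}"
definition it :: "int set \<Rightarrow> int set" where "it S = {p. p \<in> S \<and> p - 1 \<in> S}"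
text \<open>For finite \<open>S\<close>, a maximal run of m intervals has m - 1 interior integer
  points, so the difference counts the maximal runs.\<close>

definition runs :: "int set \<Rightarrow> int" where "runs S = int (card S) - int (card (it S))"

lemma cl_mono: "S \<subseteq> T \<Longrightarrow> cl S \<subseteq> cl T"
  by (auto simp: cl_def)

lemma cl_eq: "cl S = S \<union> (+) 1 ` S" and it_eq: "it S = S \<inter> (+) 1 ` S"
proof -
  have "p \<in> (+) 1 ` S \<longleftrightarrow> p - 1 \<in> S" for p :: int
    by (auto intro: image_eqI[of _ _ "p - 1"])
  then show "cl S = S \<union> (+) 1 ` S" "it S = S \<inter> (+) 1 ` S"
    by (auto simp: cl_def it_def)
qed

lemma finite_cl [simp]: "finite S \<Longrightarrow> finite (cl S)" and finite_it [simp]: "finite S \<Longrightarrow> finite (it S)"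
  by (simp_all add: cl_eq it_eq)

lemma card_cl_it: "finite S \<Longrightarrow> int (card (cl S)) + int (card (it S)) = 2 * int (card S)"
  using card_Un_Int[of S "(+) 1 ` S"] by (simp add: cl_eq it_eq card_image)

lemma card_cl: "finite S \<Longrightarrow> int (card (cl S)) = int (card S) + runs S"
  using card_cl_it[of S] by (simp add: runs_def)

lemma card_it: "int (card (it S)) = int (card S) - runs S"
  by (simp add: runs_def)

lemma runs_empty [simp]: "runs {} = 0"
  by (simp add: runs_def it_def)

lemma runs_le_card: "runs S \<le> int (card S)"
  by (simp add: runs_def)

text \<open>The least element starts a run, so it is missing from \<open>it S\<close>.\<close>

lemma runs_pos:
  assumes "finite S" "S \<noteq> {}" shows "runs S \<ge> 1"
proof -
  have "Min S - 1 \<notin> S"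
    using assms Min_le[of S "Min S - 1"] by auto
  then have "it S \<subset> S"
    using Min_in[OF assms] by (auto simp: it_def)
  then show ?thesis
    using psubset_card_mono[OF assms(1), of "it S"] by (simp add: runs_def)
qed

lemma runs_atLeastLessThan [simp]: "n > 0 \<Longrightarrow> runs {0..<int n} = 1"
proof -
  assume "n > 0"
  have "it {0..<int n} = {1..<int n}" by (auto simp: it_def)
  then show ?thesis using \<open>n > 0\<close> by (simp add: runs_def)
qed

text \<open>The \<open>card S + runs S\<close> integer points of the closure lie among
  \<open>n + 1\<close> points, and there are at least as many elements as runs.\<close>

lemma runs_le_half:
  assumes "S \<subseteq> {0..<int n}" shows "runs S \<le> int ((n + 1) div 2)"
proof -
  have fin: "finite S" using assms finite_subset by blast
  have "cl S \<subseteq> {0..int n}" using assms by (auto simp: cl_def)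
  then have "card (cl S) \<le> card {0..int n}" by (rule card_mono[rotated]) simp
  then have "2 * runs S \<le> int n + 1"
    using card_cl[OF fin] card_it[of S] by simp
  then show ?thesis by linarith
qed

section \<open>Cell counts in the plane between two layers\<close>

text \<open>Cells of the unit square grid in the plane are named by their lower left corner; such a cell
of a horizontal plane is on the boundary iff the squares of the layers A below and B above that
touch it are neither all absent nor all present.\<close>

definition bV :: "(int \<times> int) set \<Rightarrow> (int \<times> int) set \<Rightarrow> (int \<times> int) set" where
  "bV A B = {(x, y). (\<exists>a\<in>{x, x - 1}. \<exists>b\<in>{y, y - 1}. (a, b) \<in> A \<union> B) \<and>
     \<not> (\<forall>a\<in>{x, x - 1}. \<forall>b\<in>{y, y - 1}. (a, b) \<in> A \<inter> B)}"

definition bX :: "(int \<times> int) set \<Rightarrow> (int \<times> int) set \<Rightarrow> (int \<times> int) set" where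
  "bX A B = {(x, y). (\<exists>b\<in>{y, y - 1}. (x, b) \<in> A \<union> B) \<and> \<not> (\<forall>b\<in>{y, y - 1}. (x, b) \<in> A \<inter> B)}"

definition bY :: "(int \<times> int) set \<Rightarrow> (int \<times> int) set \<Rightarrow> (int \<times> int) set" where
  "bY A B = {(x, y). (\<exists>a\<in>{x, x - 1}. (a, y) \<in> A \<union> B) \<and> \<not> (\<forall>a\<in>{x, x - 1}. (a, y) \<in> A \<inter> B)}"

definition bF :: "(int \<times> int) set \<Rightarrow> (int \<times> int) set \<Rightarrow> (int \<times> int) set" where
  "bF A B = (A \<union> B) - (A \<inter> B)"

definition ec :: "(int \<times> int) set \<Rightarrow> (int \<times> int) set \<Rightarrow> int" where
  "ec A B = int (card (bV A B)) - int (card (bX A B)) - int (card (bY A B)) + int (card (bF A B))"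

lemma b_commute: "bV A B = bV B A" "bX A B = bX B A" "bY A B = bY B A" "bF A B = bF B A"
  unfolding bV_def bX_def bY_def bF_def by (simp_all add: Un_commute Int_commute)

lemma ec_commute: "ec A B = ec B A"
  unfolding ec_def by (simp only: b_commute[of A B])

text \<open>All four kinds of plane cells form such a set: two rectangles crossing in
  \<open>X' \<times> Y\<close>, or their closures, with a rectangle cut out of the crossing.\<close>

lemma card_cross:
  assumes "finite X" "finite Y'" "X' \<subseteq> X" "Y \<subseteq> Y'" "U \<subseteq> X'" "W \<subseteq> Y"
    and "D = (X \<times> Y \<union> X' \<times> Y') - U \<times> W"
  shows "int (card D) = int (card X) * int (card Y) + int (card X') * int (card Y')
    - int (card X') * int (card Y) - int (card U) * int (card W)" and "finite D"
proof -
  have fin: "finite X'" "finite Y" "finite U" "finite W"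
    using assms finite_subset by metis+
  have "U \<times> W \<subseteq> X \<times> Y \<union> X' \<times> Y'" using assms by blast
  then have "card D = card (X \<times> Y \<union> X' \<times> Y') - card (U \<times> W)"
    and "card (U \<times> W) \<le> card (X \<times> Y \<union> X' \<times> Y')"
    unfolding assms(7) using assms(1,2) fin by (blast intro: card_Diff_subset card_mono finite_SigmaI finite_UnI)+
  then have 1: "int (card D) = int (card (X \<times> Y \<union> X' \<times> Y')) - int (card (U \<times> W))"
    by (metis of_nat_diff)
  have "(X \<times> Y) \<inter> (X' \<times> Y') = X' \<times> Y" using assms by blast
  then have "card (X \<times> Y) + card (X' \<times> Y') = card (X \<times> Y \<union> X' \<times> Y') + card (X' \<times> Y)"
    using card_Un_Int[of "X \<times> Y" "X' \<times> Y'"] assms fin by simp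
  then have "int (card X) * int (card Y) + int (card X') * int (card Y')
     = int (card (X \<times> Y \<union> X' \<times> Y')) + int (card X') * int (card Y)"
    by (simp only: card_cartesian_product flip: of_nat_add of_nat_mult)
  with 1 show "int (card D) = int (card X) * int (card Y) + int (card X') * int (card Y')
    - int (card X') * int (card Y) - int (card U) * int (card W)"
    by (simp add: card_cartesian_product)
  show "finite D" using assms fin by simp
qed

text \<open>In a coordinate where the cell is a point it has two neighbours, so touching becomes
  membership in \<open>cl\<close> and being surrounded membership in \<open>it\<close>; along the
  cell the set is unchanged. Only the crossing \<open>X' \<times> Y\<close> lies in both
  layers.\<close>

lemma b_cross:
  assumes "X' \<subseteq> X" "Y \<subseteq> Y'"
  shows "bV (X \<times> Y) (X' \<times> Y') = (cl X \<times> cl Y \<union> cl X' \<times> cl Y') - it X' \<times> it Y"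
    and "bX (X \<times> Y) (X' \<times> Y') = (X \<times> cl Y \<union> X' \<times> cl Y') - X' \<times> it Y"
    and "bY (X \<times> Y) (X' \<times> Y') = (cl X \<times> Y \<union> cl X' \<times> Y') - it X' \<times> Y"
    and "bF (X \<times> Y) (X' \<times> Y') = (X \<times> Y \<union> X' \<times> Y') - X' \<times> Y"
proof -
  note sub = subsetD[OF assms(1)] subsetD[OF assms(2)]
  show "bX (X \<times> Y) (X' \<times> Y') = (X \<times> cl Y \<union> X' \<times> cl Y') - X' \<times> it Y"
    "bY (X \<times> Y) (X' \<times> Y') = (cl X \<times> Y \<union> cl X' \<times> Y') - it X' \<times> Y"
    "bF (X \<times> Y) (X' \<times> Y') = (X \<times> Y \<union> X' \<times> Y') - X' \<times> Y"
    using sub unfolding bX_def bY_def bF_def cl_def it_def by auto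
  show "bV (X \<times> Y) (X' \<times> Y') = (cl X \<times> cl Y \<union> cl X' \<times> cl Y') - it X' \<times> it Y"
  proof (rule set_eqI, clarify)
    fix x y
    have "x \<in> X' \<longrightarrow> x \<in> X" "x - 1 \<in> X' \<longrightarrow> x - 1 \<in> X" "y \<in> Y \<longrightarrow> y \<in> Y'" "y - 1 \<in> Y \<longrightarrow> y - 1 \<in> Y'"
      using sub by blast+
    then show "(x, y) \<in> bV (X \<times> Y) (X' \<times> Y') \<longleftrightarrow>
        (x, y) \<in> (cl X \<times> cl Y \<union> cl X' \<times> cl Y') - it X' \<times> it Y"
      unfolding bV_def cl_def it_def
      by (cases "x \<in> X'"; cases "x - 1 \<in> X'"; cases "y \<in> Y"; cases "y - 1 \<in> Y"; simp; blast?)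
  qed
qed

lemma it_subset: "it S \<subseteq> S" "it S \<subseteq> cl S" and subset_cl: "S \<subseteq> cl S"
  by (auto simp: it_def cl_def)

text \<open>After closures and interiors are replaced by \<open>card\<close> plus or minus
  \<open>runs\<close>, all cardinalities cancel. Full \<open>X\<close> and \<open>Y'\<close> give a
  plane between two levels, and equal layers give 0 for a slab.\<close>

lemma
  assumes "finite X" "finite Y'" "X' \<subseteq> X" "Y \<subseteq> Y'"
  shows ec_cross: "ec (X \<times> Y) (X' \<times> Y') = runs X * runs Y + runs X' * runs Y' - 2 * runs X' * runs Y"
    and finite_b_cross: "finite (bV (X \<times> Y) (X' \<times> Y'))" "finite (bX (X \<times> Y) (X' \<times> Y'))"
      "finite (bY (X \<times> Y) (X' \<times> Y'))" "finite (bF (X \<times> Y) (X' \<times> Y'))"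
proof -
  have fin: "finite X'" "finite Y"
    using assms finite_subset by metis+
  note sub = assms cl_mono[OF assms(3)] cl_mono[OF assms(4)] it_subset subset_cl
  note V = card_cross[OF _ _ _ _ _ _ b_cross(1)[OF assms(3,4)]]
  note E = card_cross[OF _ _ _ _ _ _ b_cross(2)[OF assms(3,4)]]
  note E' = card_cross[OF _ _ _ _ _ _ b_cross(3)[OF assms(3,4)]]
  note F = card_cross[OF _ _ _ _ _ _ b_cross(4)[OF assms(3,4)]]
  show "finite (bV (X \<times> Y) (X' \<times> Y'))" "finite (bX (X \<times> Y) (X' \<times> Y'))"
      "finite (bY (X \<times> Y) (X' \<times> Y'))" "finite (bF (X \<times> Y) (X' \<times> Y'))"
    using V(2) E(2) E'(2) F(2) sub by simp_all
  show "ec (X \<times> Y) (X' \<times> Y') = runs X * runs Y + runs X' * runs Y' - 2 * runs X' * runs Y"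
    unfolding ec_def using V(1) E(1) E'(1) F(1) sub fin
    by (simp add: card_cl card_it algebra_simps)
qed

section \<open>Boundary cells of a configuration by height\<close>

text \<open>Slot \<open>j\<close> is the unit interval starting at \<open>j - 1\<close>. Emptiness
  outside the tower lets the ground plane and the plane on top be treated like all others.\<close>

definition slots :: "config \<Rightarrow> int \<Rightarrow> int set" where
  "slots Q z = (if 0 \<le> z \<and> z < int (length Q) then (\<lambda>j. int j - 1) ` (Q ! nat z) else {})"

definition slice :: "nat \<Rightarrow> config \<Rightarrow> int \<Rightarrow> (int \<times> int) set" where
  "slice n Q z = (if even z then {0..<int n} \<times> slots Q z else slots Q z \<times> {0..<int n})"

lemma cubes_iff: "(x, y, z) \<in> cubes n Q \<longleftrightarrow> (x, y) \<in> slice n Q z"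
proof (cases "0 \<le> z")
  case True
  then obtain i where "z = int i" using nonneg_int_cases by blast
  then show ?thesis by (auto simp: cubes_def slice_def slots_def)
qed (auto simp: cubes_def slice_def slots_def)

text \<open>A vertical cell projects to a plane cell of one dimension less, so the cells inside the
  slab at \<open>z\<close> are plane cells with both layers equal to
  \<open>slice n Q z\<close>.\<close>

lemma bdry_faces_iff:
  "(d, x, y, z) \<in> bdry_faces n Q \<longleftrightarrow>
     d = 0 \<and> (x, y) \<in> bY (slice n Q z) (slice n Q z) \<or>
     d = 1 \<and> (x, y) \<in> bX (slice n Q z) (slice n Q z) \<or>
     d = 2 \<and> (x, y) \<in> bF (slice n Q (z - 1)) (slice n Q z)"
proof -
  have "d < 3 \<longleftrightarrow> d = 0 \<or> d = 1 \<or> d = 2" by linarith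
  then show ?thesis
    by (auto simp: bdry_faces_def psub_def cubes_iff bX_def bY_def bF_def)
qed

lemma ex_face: "(\<exists>t\<in>bdry_faces n Q. P t) \<longleftrightarrow>
    (\<exists>x y z. (x, y) \<in> bY (slice n Q z) (slice n Q z) \<and> P (0, x, y, z)) \<or>
    (\<exists>x y z. (x, y) \<in> bX (slice n Q z) (slice n Q z) \<and> P (1, x, y, z)) \<or>
    (\<exists>x y z. (x, y) \<in> bF (slice n Q (z - 1)) (slice n Q z) \<and> P (2, x, y, z))"
  unfolding Bex_def split_paired_Ex bdry_faces_iff
  by (simp add: conj_disj_distribR ex_disj_distrib)

lemma face_edges_simps:
  "face_edges 0 (x, y, z) = {(1, x, y, z), (1, x, y, z + 1), (2, x, y, z), (2, x, y + 1, z)}"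
  "face_edges (Suc 0) (x, y, z) = {(2, x, y, z), (2, x + 1, y, z), (0, x, y, z), (0, x, y, z + 1)}"
  "face_edges 2 (x, y, z) = {(0, x, y, z), (0, x, y + 1, z), (1, x, y, z), (1, x + 1, y, z)}"
  by (simp_all add: face_edges_def padd_def Let_def flip: numeral_2_eq_2)

lemma face_verts_simps:
  "face_verts 0 (x, y, z) = {(x, y, z), (x, y + 1, z), (x, y, z + 1), (x, y + 1, z + 1)}"
  "face_verts (Suc 0) (x, y, z) = {(x, y, z), (x, y, z + 1), (x + 1, y, z), (x + 1, y, z + 1)}"
  "face_verts 2 (x, y, z) = {(x, y, z), (x + 1, y, z), (x, y + 1, z), (x + 1, y + 1, z)}"
  by (simp_all add: face_verts_def padd_def Let_def flip: numeral_2_eq_2)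

lemma shift_eq: "(a::int) = b + 1 \<longleftrightarrow> b = a - 1"
  by auto

text \<open>Four squares meet at an edge and separate four cubes in cyclic order. If these are
  neither all absent nor all present, two consecutive ones differ, and the square between them is on
  the boundary.\<close>

lemma bdry_edges_iff:
  "(d, x, y, z) \<in> bdry_edges n Q \<longleftrightarrow>
     d = 0 \<and> (x, y) \<in> bX (slice n Q (z - 1)) (slice n Q z) \<or>
     d = 1 \<and> (x, y) \<in> bY (slice n Q (z - 1)) (slice n Q z) \<or>
     d = 2 \<and> (x, y) \<in> bV (slice n Q z) (slice n Q z)"
proof -
  have "(d, x, y, z) \<in> bdry_edges n Q \<longleftrightarrow>
     d = 0 \<and> ((x, y) \<in> bX (slice n Q z) (slice n Q z) \<or> (x, y) \<in> bX (slice n Q (z - 1)) (slice n Q (z - 1))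
        \<or> (x, y) \<in> bF (slice n Q (z - 1)) (slice n Q z) \<or> (x, y - 1) \<in> bF (slice n Q (z - 1)) (slice n Q z)) \<or>
     d = 1 \<and> ((x, y) \<in> bY (slice n Q z) (slice n Q z) \<or> (x, y) \<in> bY (slice n Q (z - 1)) (slice n Q (z - 1))
        \<or> (x, y) \<in> bF (slice n Q (z - 1)) (slice n Q z) \<or> (x - 1, y) \<in> bF (slice n Q (z - 1)) (slice n Q z)) \<or>
     d = 2 \<and> ((x, y) \<in> bX (slice n Q z) (slice n Q z) \<or> (x - 1, y) \<in> bX (slice n Q z) (slice n Q z)
        \<or> (x, y) \<in> bY (slice n Q z) (slice n Q z) \<or> (x, y - 1) \<in> bY (slice n Q z) (slice n Q z))"
    unfolding bdry_edges_def UN_iff ex_face split_conv One_nat_def face_edges_simps insert_iff empty_iff prod.inject shift_eq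
    by (cases "d = 0"; cases "d = 1"; cases "d = 2")
      (simp_all add: ex_disj_distrib conj_disj_distribL disj_ac)
  also have "\<dots> \<longleftrightarrow>
     d = 0 \<and> (x, y) \<in> bX (slice n Q (z - 1)) (slice n Q z) \<or>
     d = 1 \<and> (x, y) \<in> bY (slice n Q (z - 1)) (slice n Q z) \<or>
     d = 2 \<and> (x, y) \<in> bV (slice n Q z) (slice n Q z)"
    unfolding bV_def bX_def bY_def bF_def by (cases "d = 0"; cases "d = 1"; cases "d = 2"; simp; blast?)
  finally show ?thesis .
qed

text \<open>The same argument for the eight cubes at a vertex, which are connected through the
  twelve squares between adjacent ones.\<close>

lemma bdry_verts_iff:
  "(x, y, z) \<in> bdry_verts n Q \<longleftrightarrow> (x, y) \<in> bV (slice n Q (z - 1)) (slice n Q z)"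
proof -
  have "(x, y, z) \<in> bdry_verts n Q \<longleftrightarrow>
     (\<exists>c\<in>{z, z - 1}. (\<exists>b\<in>{y, y - 1}. (x, b) \<in> bY (slice n Q c) (slice n Q c)) \<or>
       (\<exists>a\<in>{x, x - 1}. (a, y) \<in> bX (slice n Q c) (slice n Q c))) \<or>
     (\<exists>a\<in>{x, x - 1}. \<exists>b\<in>{y, y - 1}. (a, b) \<in> bF (slice n Q (z - 1)) (slice n Q z))"
    unfolding bdry_verts_def UN_iff ex_face split_conv One_nat_def face_verts_simps insert_iff empty_iff prod.inject shift_eq
    by (simp add: ex_disj_distrib conj_disj_distribL) blast
  also have "\<dots> \<longleftrightarrow> (x, y) \<in> bV (slice n Q (z - 1)) (slice n Q z)"
    unfolding bV_def bX_def bY_def bF_def by simp blast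
  finally show ?thesis .
qed


section \<open>The Euler characteristic as a sum over layers\<close>

lemma layers:
  fixes G :: "int \<Rightarrow> (int \<times> int) set"
  assumes "finite K" "\<And>z. z \<notin> K \<Longrightarrow> G z = {}" "\<And>z. finite (G z)"
  shows finite_layers: "finite {(x, y, z). (x, y) \<in> G z}"
    and card_layers: "card {(x, y, z). (x, y) \<in> G z} = (\<Sum>z\<in>K. card (G z))"
proof -
  have "{(x, y, z). (x, y) \<in> G z} = (\<lambda>(z, x, y). (x, y, z)) ` Sigma K G"
    using assms(2) by (force simp: image_iff)
  moreover have "inj_on (\<lambda>(z, x, y). (x, y, z)) (Sigma K G)"
    by (auto simp: inj_on_def)
  ultimately show "card {(x, y, z). (x, y) \<in> G z} = (\<Sum>z\<in>K. card (G z))"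
    "finite {(x, y, z). (x, y) \<in> G z}"
    using assms(1,3) by (simp_all add: card_image)
qed

lemma card_cells:
  fixes G0 G1 G2 :: "int \<Rightarrow> (int \<times> int) set" and C :: "(nat \<times> pt) set"
  assumes "finite K" "\<And>z. z \<notin> K \<Longrightarrow> G0 z = {} \<and> G1 z = {} \<and> G2 z = {}"
    and "\<And>z. finite (G0 z) \<and> finite (G1 z) \<and> finite (G2 z)"
    and C: "\<And>d x y z. (d, x, y, z) \<in> C \<longleftrightarrow>
      d = 0 \<and> (x, y) \<in> G0 z \<or> d = 1 \<and> (x, y) \<in> G1 z \<or> d = 2 \<and> (x, y) \<in> G2 z"
  shows "card C = (\<Sum>z\<in>K. card (G0 z) + card (G1 z) + card (G2 z))"
proof -
  let ?L = "\<lambda>G. {(x, y, z). (x, y) \<in> (G :: int \<Rightarrow> (int \<times> int) set) z}"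
  have C_eq: "C = Pair 0 ` ?L G0 \<union> (Pair 1 ` ?L G1 \<union> Pair 2 ` ?L G2)"
    by (auto simp: C)
  have fin: "finite (?L G0)" "finite (?L G1)" "finite (?L G2)"
    using assms by (simp_all add: finite_layers[where K = K])
  have "card C = card (Pair (0::nat) ` ?L G0) + (card (Pair (1::nat) ` ?L G1) + card (Pair (2::nat) ` ?L G2))"
    unfolding C_eq using fin by (subst card_Un_disjoint; (subst card_Un_disjoint)?; auto)
  also have "\<dots> = card (?L G0) + (card (?L G1) + card (?L G2))"
    by (simp add: card_image inj_on_def)
  also have "\<dots> = (\<Sum>z\<in>K. card (G0 z) + card (G1 z) + card (G2 z))"
    using assms by (simp add: card_layers[where K = K] sum.distrib)
  finally show ?thesis .
qed

definition valid :: "nat \<Rightarrow> config \<Rightarrow> bool" where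
  "valid n Q \<longleftrightarrow> (\<forall>i < length Q. Q ! i \<subseteq> {1..n})"

lemma slots_subset: "valid n Q \<Longrightarrow> slots Q z \<subseteq> {0..<int n}"
  by (auto simp: slots_def valid_def nat_less_iff dest!: spec[of _ "nat z"])

lemma slots_outside: "z \<notin> {0..<int (length Q)} \<Longrightarrow> slots Q z = {}"
  by (auto simp: slots_def)

lemma slice_outside: "z \<notin> {0..<int (length Q)} \<Longrightarrow> slice n Q z = {}"
  by (simp add: slice_def slots_outside)

text \<open>The parity of \<open>z\<close> decides which of the two layers runs along the x-axis;
  symmetry in the two layers reduces both parities to the crossing pattern.\<close>

lemma
  assumes "valid n Q"
  shows finite_b_slices: "finite (bV (slice n Q (z - 1)) (slice n Q z))" "finite (bX (slice n Q (z - 1)) (slice n Q z))"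
      "finite (bY (slice n Q (z - 1)) (slice n Q z))" "finite (bF (slice n Q (z - 1)) (slice n Q z))"
    and ec_slices: "n > 0 \<Longrightarrow> ec (slice n Q (z - 1)) (slice n Q z) = runs (slots Q (z - 1)) + runs (slots Q z)
      - 2 * runs (slots Q (z - 1)) * runs (slots Q z)"
proof -
  let ?I = "{0..<int n}"
  note s = slots_subset[OF assms, of z] slots_subset[OF assms, of "z - 1"]
  note c1 = finite_b_cross[of ?I ?I "slots Q z" "slots Q (z - 1)"]
    and c2 = finite_b_cross[of ?I ?I "slots Q (z - 1)" "slots Q z"]
  show "finite (bV (slice n Q (z - 1)) (slice n Q z))" "finite (bX (slice n Q (z - 1)) (slice n Q z))"
      "finite (bY (slice n Q (z - 1)) (slice n Q z))" "finite (bF (slice n Q (z - 1)) (slice n Q z))"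
    using c1 c2 s by (auto simp: slice_def b_commute[of "?I \<times> slots Q z" "slots Q (z - 1) \<times> ?I"])
  show "ec (slice n Q (z - 1)) (slice n Q z) = runs (slots Q (z - 1)) + runs (slots Q z)
      - 2 * runs (slots Q (z - 1)) * runs (slots Q z)" if "n > 0"
    using ec_cross[of ?I ?I "slots Q z" "slots Q (z - 1)"] ec_cross[of ?I ?I "slots Q (z - 1)" "slots Q z"] s that
    by (auto simp: slice_def ec_commute[of "slots Q (z - 1) \<times> ?I"])
qed

lemma
  assumes "valid n Q"
  shows finite_b_slice: "finite (bV (slice n Q z) (slice n Q z))" "finite (bX (slice n Q z) (slice n Q z))"
      "finite (bY (slice n Q z) (slice n Q z))"
    and ec_slice: "ec (slice n Q z) (slice n Q z) = 0"
proof -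
  let ?I = "{0..<int n}"
  have s: "finite (slots Q z)" using slots_subset[OF assms] finite_subset by blast
  note c1 = finite_b_cross[of ?I "slots Q z" ?I "slots Q z"] and c2 = finite_b_cross[of "slots Q z" ?I "slots Q z" ?I]
  show "finite (bV (slice n Q z) (slice n Q z))" "finite (bX (slice n Q z) (slice n Q z))"
      "finite (bY (slice n Q z) (slice n Q z))"
    using c1 c2 s by (auto simp: slice_def)
  show "ec (slice n Q z) (slice n Q z) = 0"
    using ec_cross[of ?I "slots Q z" ?I "slots Q z"] ec_cross[of "slots Q z" ?I "slots Q z" ?I] s
    by (auto simp: slice_def)
qed

lemma b_empty: "bV {} {} = {}" "bX {} {} = {}" "bY {} {} = {}" "bF {} {} = {}"
  by (auto simp: bV_def bX_def bY_def bF_def)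

lemma euler_char_layers:
  assumes "valid n Q"
  shows "euler_char n Q = (\<Sum>z\<in>{0..int (length Q)}. ec (slice n Q (z - 1)) (slice n Q z))"
proof -
  let ?K = "{0..int (length Q)}"
  have out: "slice n Q z = {} \<and> slice n Q (z - 1) = {}" if "z \<notin> ?K" for z
    using that by (auto intro!: slice_outside)
  have "bdry_verts n Q = {(x, y, z). (x, y) \<in> bV (slice n Q (z - 1)) (slice n Q z)}"
    by (auto simp: bdry_verts_iff)
  then have V: "card (bdry_verts n Q) = (\<Sum>z\<in>?K. card (bV (slice n Q (z - 1)) (slice n Q z)))"
    using out finite_b_slices[OF assms]
    by (simp only:) (rule card_layers; auto simp: b_empty)
  have E: "card (bdry_edges n Q) = (\<Sum>z\<in>?K. card (bX (slice n Q (z - 1)) (slice n Q z))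
      + card (bY (slice n Q (z - 1)) (slice n Q z)) + card (bV (slice n Q z) (slice n Q z)))"
    by (rule card_cells[OF _ _ _ bdry_edges_iff])
      (use out in \<open>auto simp: b_empty finite_b_slices[OF assms] finite_b_slice[OF assms]\<close>)
  have F: "card (bdry_faces n Q) = (\<Sum>z\<in>?K. card (bY (slice n Q z) (slice n Q z))
      + card (bX (slice n Q z) (slice n Q z)) + card (bF (slice n Q (z - 1)) (slice n Q z)))"
    by (rule card_cells[OF _ _ _ bdry_faces_iff])
      (use out in \<open>auto simp: b_empty finite_b_slices[OF assms] finite_b_slice[OF assms]\<close>)
  \<comment> \<open>A vertical cell has one dimension more than its projection, hence the opposite
    sign: each slab enters as minus \<open>ec\<close> of its slice with itself. The
    \<open>bF\<close> term would stand for solid cubes and is empty.\<close>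
  have "bF (slice n Q z) (slice n Q z) = {}" for z by (simp add: bF_def)
  then have "euler_char n Q = (\<Sum>z\<in>?K. ec (slice n Q (z - 1)) (slice n Q z) - ec (slice n Q z) (slice n Q z))"
    unfolding euler_char_def V E F ec_def of_nat_sum
    by (simp add: sum_subtractf[symmetric] sum.distrib[symmetric] algebra_simps)
  then show ?thesis by (simp add: ec_slice[OF assms])
qed

section \<open>The genus in terms of runs\<close>

definition lruns :: "config \<Rightarrow> nat \<Rightarrow> int" where
  "lruns Q i = runs ((\<lambda>j. int j - 1) ` (Q ! i))"

lemma runs_slots: "i < length Q \<Longrightarrow> runs (slots Q (int i)) = lruns Q i"
  by (simp add: slots_def lruns_def)

text \<open>Each level meets two planes, so its runs count twice, while a product survives only at a
  plane with levels on both sides.\<close>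

lemma euler_char_eq:
  assumes "valid n Q" "n > 0" "length Q = Suc m"
  shows "euler_char n Q = 2 * ((\<Sum>i<Suc m. lruns Q i) - (\<Sum>i<m. lruns Q i * lruns Q (Suc i)))"
proof -
  define f where "f z = runs (slots Q z)" for z
  have f: "f (-1) = 0" "f (1 + int m) = 0" "\<And>i. i < Suc m \<Longrightarrow> f (int i) = lruns Q i"
    using assms(3) by (auto simp: f_def slots_outside runs_slots)
  have "{0..int (Suc m)} = int ` {..<m + 2}"
    by (auto simp: image_iff intro!: bexI[of _ "nat _"])
  then have "euler_char n Q = (\<Sum>i<m + 2. f (int i - 1) + f (int i) - 2 * f (int i - 1) * f (int i))"
    unfolding euler_char_layers[OF assms(1)] ec_slices[OF assms(1,2)] assms(3) f_def
    by (simp add: sum.reindex)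
  also have "\<dots> = (\<Sum>i<m + 2. f (int i - 1)) + (\<Sum>i<m + 2. f (int i)) - 2 * (\<Sum>i<m + 2. f (int i - 1) * f (int i))"
    by (simp add: sum_subtractf sum.distrib sum_distrib_left mult.assoc)
  also have "(\<Sum>i<m + 2. f (int i - 1)) = (\<Sum>i<Suc m. f (int i))"
    using f(1) by (simp add: sum.lessThan_Suc_shift del: sum.lessThan_Suc)
  also have "(\<Sum>i<m + 2. f (int i)) = (\<Sum>i<Suc m. f (int i))"
    using f(2) by simp
  also have "(\<Sum>i<m + 2. f (int i - 1) * f (int i)) = (\<Sum>i<m. f (int i) * f (int (Suc i)))"
  proof -
    have "(\<Sum>i<Suc (Suc m). f (int i - 1) * f (int i)) = (\<Sum>i<Suc m. f (int i) * f (int (Suc i)))"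
      by (subst sum.lessThan_Suc_shift) (simp add: f(1) del: sum.lessThan_Suc)
    also have "\<dots> = (\<Sum>i<m. f (int i) * f (int (Suc i)))" using f(2) by simp
    finally show ?thesis by simp
  qed
  finally show ?thesis using f(3) by (simp del: of_nat_Suc)
qed

text \<open>The Euler characteristic is even, so \<open>div\<close> is exact. Each level but the
  topmost absorbs its linear term into the product with the level above.\<close>

lemma genus_eq:
  assumes "valid n Q" "n > 0" "length Q = Suc m"
  shows "genus n Q = (\<Sum>i<m. lruns Q i * (lruns Q (Suc i) - 1)) - (lruns Q m - 1)"
proof -
  have "genus n Q = 1 - (\<Sum>i<Suc m. lruns Q i) + (\<Sum>i<m. lruns Q i * lruns Q (Suc i))"
    unfolding genus_def euler_char_eq[OF assms] by simp
  then show ?thesis by (simp add: right_diff_distrib sum_subtractf)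
qed

lemma lruns_full: "n > 0 \<Longrightarrow> Q ! i = {1..n} \<Longrightarrow> lruns Q i = 1"
proof -
  have "(\<lambda>j. int j - 1) ` {1..n} = {0..<int n}"
  proof (intro equalityI subsetI)
    fix x assume "x \<in> {0..<int n}"
    then show "x \<in> (\<lambda>j. int j - 1) ` {1..n}" by (intro image_eqI[of _ _ "nat (x + 1)"]) auto
  qed auto
  then show "n > 0 \<Longrightarrow> Q ! i = {1..n} \<Longrightarrow> lruns Q i = 1"
    by (simp add: lruns_def)
qed

text \<open>The topmost level never contributes: its handle count cancels against the full level below it.\<close>

lemma genus_full_below_top:
  assumes "valid n Q" "n > 0" "length Q = m + 2" "Q ! m = {1..n}"
  shows "genus n Q = (\<Sum>i<m - 1. lruns Q i * (lruns Q (Suc i) - 1))"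
proof -
  \<comment> \<open>The single run of the full level also removes the term of index
    \<open>m - 1\<close>; for \<open>m = 0\<close> there is no such term and truncated subtraction
    leaves an empty range.\<close>
  have "lruns Q m = 1" using assms lruns_full by blast
  then show ?thesis
    using genus_eq[OF assms(1,2), of "Suc m"] assms(3) by (cases m) auto
qed

section \<open>The upper bound\<close>

text \<open>Unifies the parities in the shape in which the bound arises: the number of blocks that
  count, times one less than the largest number of runs in a level.\<close>

lemma gmax_eq:
  assumes "k \<ge> 2" shows "gmax n k = (int ((n + 1) div 2) - 1) * int (n * (k - 2))"
proof -
  obtain m where m: "k = m + 2" using assms le_Suc_ex by (metis add.commute)
  show ?thesis
  proof (cases "even n")
    case True
    then obtain r where "n = 2 * r" by blast
    then show ?thesis by (simp add: gmax_def m algebra_simps)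
  next
    case False
    then obtain r where "n = 2 * r + 1" by (elim oddE)
    then show ?thesis by (simp add: gmax_def m algebra_simps)
  qed
qed

text \<open>The last clause holds because blocks leave the level two below the top only after the
topmost level was started, so all of them are in the topmost level.\<close>

definition reach_inv :: "nat \<Rightarrow> nat \<Rightarrow> config \<Rightarrow> bool" where
  "reach_inv n k Q \<longleftrightarrow> (\<exists>P T. Q = P @ [{1..n}, T] \<and> (\<forall>S\<in>set P. S \<subseteq> {1..n}) \<and> T \<subseteq> {1..n} \<and>
     sum_list (map card P) + n + card T = n * k \<and> (P \<noteq> [] \<longrightarrow> n \<le> card T + card (last P)))"

lemma reach_inv_initial:
  assumes "k \<ge> 2" shows "reach_inv n k (initial_config n k)"
proof -
  obtain m where "k = m + 2" using assms le_Suc_ex by (metis add.commute)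
  then have "initial_config n k = replicate m {1..n} @ [{1..n}, {1..n}]"
    using replicate_add[of m 2 "{1..n}"] by (simp add: initial_config_def numeral_2_eq_2)
  then show ?thesis unfolding reach_inv_def
    using \<open>k = m + 2\<close> by (intro exI[of _ "replicate m {1..n}"] exI[of _ "{1..n}"])
      (auto simp: sum_list_replicate algebra_simps)
qed

lemma sum_card_remove:
  assumes "l < length P" "j \<in> P ! l" "finite (P ! l)"
  shows "sum_list (map card (P[l := P ! l - {j}])) + 1 = sum_list (map card P)"
proof -
  have "card (P ! l) \<ge> 1" using assms card_gt_0_iff by (metis One_nat_def Suc_leI empty_iff)
  moreover have "card (P ! l) \<le> sum_list (map card P)"
    using assms by (intro member_le_sum_list) auto
  ultimately show ?thesis
    using assms by (simp add: map_update sum_list_update)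
qed

text \<open>While the top is being filled, the level two below it loses at most one block per move
  and the top gains one. Opening a new level re-establishes the last clause, since the level then
  two below the top was full before the move.\<close>

lemma reach_inv_step:
  assumes n: "n \<ge> 2" and inv: "reach_inv n k Q" and move: "jmove n Q Q'"
  shows "reach_inv n k Q'"
proof -
  obtain P T where Q: "Q = P @ [{1..n}, T]" and P: "\<forall>S\<in>set P. S \<subseteq> {1..n}" and T: "T \<subseteq> {1..n}"
    and sum: "sum_list (map card P) + n + card T = n * k"
    and last: "P \<noteq> [] \<longrightarrow> n \<le> card T + card (last P)"
    using inv unfolding reach_inv_def by blast
  have finT: "finite T" using T finite_subset by blast
  have lastQ: "List.last Q = T" by (simp add: Q)
  obtain l j where l: "l + 1 < length Q" "card T < n \<longrightarrow> l + 2 < length Q" and j: "j \<in> Q ! l"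
    and Q': "if card T < n then \<exists>s \<in> {1..n} - T. Q' = (Q[l := Q ! l - {j}])[length Q - 1 := insert s T]
      else \<exists>s \<in> {1..n}. Q' = Q[l := Q ! l - {j}] @ [{s}]"
    using move unfolding jmove_def lastQ by blast
  show ?thesis
  proof (cases "card T < n")
    case True
    then obtain s where s: "s \<in> {1..n} - T" and Q': "Q' = (Q[l := Q ! l - {j}])[length Q - 1 := insert s T]"
      using Q' by auto
    have lP: "l < length P" using l True Q by simp
    then have Pl: "Q ! l = P ! l" by (simp add: Q nth_append)
    have fin: "finite (P ! l)" using P nth_mem[OF lP] by (meson finite_atLeastAtMost finite_subset)
    let ?P = "P[l := P ! l - {j}]"
    have "Q' = ?P @ [{1..n}, insert s T]"
      unfolding Q' Pl using lP by (simp add: Q list_update_append)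
    moreover have "\<forall>S\<in>set ?P. S \<subseteq> {1..n}"
      using P lP by (auto dest!: set_update_subset_insert[THEN subsetD] dest: nth_mem)
    moreover have "sum_list (map card ?P) + n + card (insert s T) = n * k"
      using sum sum_card_remove[OF lP j[unfolded Pl] fin] s finT by simp
    moreover have "n \<le> card (insert s T) + card (last ?P)"
    proof -
      have ne: "P \<noteq> []" using lP by auto
      have "card (last P) \<le> card (last ?P) + 1"
        using ne lP fin card_Diff_singleton_if[of "P ! l" j] by (auto simp: last_conv_nth nth_list_update)
      then show ?thesis using last ne s finT by simp
    qed
    ultimately show ?thesis using s T unfolding reach_inv_def by fast
  next
    case False
    then have T_full: "T = {1..n}" using T by (intro card_seteq) auto
    obtain s where s: "s \<in> {1..n}" and Q': "Q' = Q[l := Q ! l - {j}] @ [{s}]"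
      using Q' False by auto
    \<comment> \<open>The old top is full and becomes the level just below the new one; the previous
      full level joins the lower ones and may lose the block.\<close>
    define R where "R = P @ [{1..n}]"
    have lR: "l < length R" using l by (simp add: Q R_def)
    have QR: "Q = R @ [{1..n}]" by (simp add: Q R_def T_full)
    have Rl: "Q ! l = R ! l" using lR by (simp add: QR nth_append)
    have R: "\<forall>S\<in>set R. S \<subseteq> {1..n}" using P by (auto simp: R_def)
    have fin: "finite (R ! l)" using R nth_mem[OF lR] by (meson finite_atLeastAtMost finite_subset)
    let ?P = "R[l := R ! l - {j}]"
    have "Q' = ?P @ [{1..n}, {s}]"
      unfolding Q' Rl using lR by (simp add: QR list_update_append)
    moreover have "\<forall>S\<in>set ?P. S \<subseteq> {1..n}"
      using R lR by (auto dest!: set_update_subset_insert[THEN subsetD] dest: nth_mem)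
    moreover have "sum_list (map card ?P) + n + card {s} = n * k"
      using sum sum_card_remove[OF lR j[unfolded Rl] fin] T_full by (simp add: R_def)
    moreover have "n \<le> card {s} + card (last ?P)"
    proof -
      have ne: "R \<noteq> []" by (simp add: R_def)
      have "card (last R) \<le> card (last ?P) + 1"
        using ne lR fin card_Diff_singleton_if[of "R ! l" j] by (auto simp: last_conv_nth nth_list_update)
      then show ?thesis by (simp add: R_def)
    qed
    ultimately show ?thesis using s unfolding reach_inv_def by fast
  qed
qed

lemma reach_inv_jenga_like:
  assumes "n \<ge> 2" "k \<ge> 2" "jenga_like n k Q" shows "reach_inv n k Q"
proof -
  have "(jmove n)\<^sup>*\<^sup>* (initial_config n k) Q" using assms(3) by (simp add: jenga_like_def)
  then show ?thesis
    by (induction rule: rtranclp_induct) (use assms reach_inv_initial reach_inv_step in blast)+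
qed

lemma lruns_bounds:
  assumes "valid n Q" "i < length Q"
  shows "lruns Q i \<le> int (card (Q ! i))" "lruns Q i \<le> int ((n + 1) div 2)"
    and "Q ! i \<noteq> {} \<Longrightarrow> lruns Q i \<ge> 1"
proof -
  have "inj_on (\<lambda>j. int j - 1) (Q ! i)" by (simp add: inj_on_def)
  then show "lruns Q i \<le> int (card (Q ! i))"
    using runs_le_card[of "(\<lambda>j. int j - 1) ` (Q ! i)"] by (simp add: lruns_def card_image)
  show "lruns Q i \<le> int ((n + 1) div 2)"
    using runs_le_half[OF slots_subset[OF assms(1)]] runs_slots[OF assms(2)] by metis
  have "finite (Q ! i)" using assms finite_subset unfolding valid_def by blast
  then show "Q ! i \<noteq> {} \<Longrightarrow> lruns Q i \<ge> 1"
    unfolding lruns_def by (intro runs_pos) auto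
qed

lemma genus_le_gmax:
  assumes n: "n \<ge> 2" and k: "k \<ge> 2" and "jenga_like n k Q"
  shows "genus n Q \<le> gmax n k"
proof -
  obtain P T where Q: "Q = P @ [{1..n}, T]" and P: "\<forall>S\<in>set P. S \<subseteq> {1..n}" and T: "T \<subseteq> {1..n}"
    and sum: "sum_list (map card P) + n + card T = n * k"
    and last: "P \<noteq> [] \<longrightarrow> n \<le> card T + card (last P)"
    using reach_inv_jenga_like[OF assms] unfolding reach_inv_def by blast
  have ne: "Q ! i \<noteq> {}" if "i < length Q" for i
    using assms(3) that by (simp add: jenga_like_def)
  have "\<forall>S\<in>set Q. S \<subseteq> {1..n}" using P T by (auto simp: Q)
  then have val: "valid n Q" by (simp add: valid_def)
  let ?R = "int ((n + 1) div 2)" and ?m = "length P"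
  \<comment> \<open>The genus sum stops before the last level of \<open>P\<close>, whose upper
    neighbour is full.\<close>
  have "(\<Sum>i<?m - 1. card (Q ! i)) = (\<Sum>i<?m - 1. card (butlast P ! i))"
    by (rule sum.cong) (auto simp: Q nth_append nth_butlast)
  also have "\<dots> = sum_list (map card (butlast P))"
    by (simp add: sum_list_sum_nth atLeast0LessThan)
  also have "\<dots> \<le> n * (k - 2)"
  proof (cases "P = []")
    case False
    then have "sum_list (map card P) = sum_list (map card (butlast P)) + card (last P)"
      by (cases P rule: rev_cases) auto
    \<comment> \<open>The full level holds \<open>n\<close> blocks, and \<open>T\<close> and
      \<open>last P\<close> together at least \<open>n\<close> more.\<close>
    then show ?thesis using sum last False by (simp add: diff_mult_distrib2)
  qed simp
  finally have *: "(\<Sum>i<?m - 1. card (Q ! i)) \<le> n * (k - 2)" .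
  have "genus n Q = (\<Sum>i<?m - 1. lruns Q i * (lruns Q (Suc i) - 1))"
    using val n by (intro genus_full_below_top) (auto simp: Q)
  also have "\<dots> \<le> (\<Sum>i<?m - 1. int (card (Q ! i)) * (?R - 1))"
  proof (intro sum_mono mult_mono)
    fix i assume "i \<in> {..<?m - 1}"
    then have "i < length Q" "Suc i < length Q" by (auto simp: Q)
    \<comment> \<open>Nonempty levels have at least one run, which gives the nonnegative factor that
      monotonicity of the product requires.\<close>
    then show "lruns Q i \<le> int (card (Q ! i))" "lruns Q (Suc i) - 1 \<le> ?R - 1" "0 \<le> lruns Q (Suc i) - 1"
      using lruns_bounds[OF val] ne by force+
  qed simp
  also have "\<dots> = (?R - 1) * int (\<Sum>i<?m - 1. card (Q ! i))"
    by (simp add: sum_distrib_left mult.commute)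
  also have "\<dots> \<le> (?R - 1) * int (n * (k - 2))"
    using * n by (intro mult_left_mono of_nat_mono) auto
  finally show ?thesis by (simp only: gmax_eq[OF k])
qed

section \<open>An optimal configuration\<close>

text \<open>The chosen slots leave gaps, so every block is a run of its own.\<close>

definition odds :: "nat \<Rightarrow> nat set" where "odds r = (\<lambda>i. 2 * i + 1) ` {..<r}"

lemma card_odds [simp]: "card (odds r) = r"
  by (simp add: odds_def card_image inj_on_def)

lemma odds_subset: "2 * r \<le> n + 1 \<Longrightarrow> odds r \<subseteq> {1..n}"
  by (auto simp: odds_def)

lemma lruns_odds: "Q ! i = odds r \<Longrightarrow> lruns Q i = int r"
proof -
  have "it ((\<lambda>j. int j - 1) ` odds r) = {}"
    by (auto simp: it_def odds_def) presburger
  moreover have "card ((\<lambda>j. int j - 1) ` odds r) = r"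
    by (subst card_image) (auto simp: inj_on_def)
  ultimately show "Q ! i = odds r \<Longrightarrow> lruns Q i = int r"
    by (simp add: lruns_def runs_def)
qed

text \<open>The configuration after t moves when A lists the bottom levels and the moved blocks were put
on top in increasing order of slots.\<close>

definition stacked :: "nat \<Rightarrow> nat \<Rightarrow> config \<Rightarrow> nat \<Rightarrow> config" where
  "stacked n k A t = A @ replicate (k + t div n - length A) {1..n} @
     (if t mod n = 0 then [] else [{1..t mod n}])"

lemma stacked_full:
  "length A < k + t div n \<Longrightarrow> stacked n k A t = stacked n k (A @ [{1..n}]) t"
  unfolding stacked_def by (cases "k + t div n - length A") (auto simp: Suc_diff_Suc)

text \<open>The bound on \<open>length B\<close> leaves a full level above \<open>S\<close>, so
  \<open>S\<close> is neither the topmost level nor directly below an incomplete one, and the move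
  is legal.\<close>

lemma jmove_stacked:
  assumes n: "n \<ge> 2" and len: "length B + 1 < k + t div n" and j: "j \<in> S"
  shows "jmove n (stacked n k (B @ [S]) t) (stacked n k (B @ [S - {j}]) (Suc t))"
proof -
  define u where "u = t mod n"
  obtain q where q: "k + t div n = Suc (Suc (length B + q))"
    using len less_imp_Suc_add by (metis Suc_eq_plus1 add_Suc)
  have st: "stacked n k (B @ [X]) t = B @ [X] @ replicate (Suc q) {1..n} @ (if u = 0 then [] else [{1..u}])" for X
    unfolding stacked_def q u_def by simp
  have "u < n" using n by (simp add: u_def)
  consider "u = 0" | "u > 0" "Suc u < n" | "u > 0" "Suc u = n"
    using \<open>u < n\<close> by linarith
  then show ?thesis
  proof cases
    case 1
    then have "Suc t mod n = 1" "Suc t div n = t div n"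
      using n by (auto simp: u_def mod_Suc div_Suc)
    then have st': "stacked n k (B @ [S - {j}]) (Suc t) = B @ [S - {j}] @ replicate (Suc q) {1..n} @ [{1}]"
      unfolding stacked_def using q by simp
    show ?thesis unfolding st st' jmove_def using 1 n j
      by (intro conjI exI[of _ "length B"] exI[of _ j]) (auto simp: nth_append list_update_append)
  next
    case 2
    then have "Suc t mod n = Suc u" "Suc t div n = t div n"
      by (auto simp: u_def mod_Suc div_Suc)
    then have st': "stacked n k (B @ [S - {j}]) (Suc t) = B @ [S - {j}] @ replicate (Suc q) {1..n} @ [{1..Suc u}]"
      unfolding stacked_def using q by simp
    show ?thesis unfolding st st' jmove_def using 2 n j
      by (intro conjI exI[of _ "length B"] exI[of _ j])
        (auto simp: nth_append list_update_append atLeastAtMostSuc_conv intro!: bexI[of _ "Suc u"])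
  next
    case 3
    then have "Suc t mod n = 0" "Suc t div n = Suc (t div n)"
      by (auto simp: u_def mod_Suc div_Suc)
    \<comment> \<open>As \<open>Suc u = n\<close>, the completed top counts as one more full
      level.\<close>
    then have st': "stacked n k (B @ [S - {j}]) (Suc t) = B @ [S - {j}] @ replicate (Suc q) {1..n} @ [{1..Suc u}]"
      unfolding stacked_def using q 3 by (simp add: replicate_append_same)
    show ?thesis unfolding st st' jmove_def using 3 n j
      by (intro conjI exI[of _ "length B"] exI[of _ j])
        (auto simp: nth_append list_update_append atLeastAtMostSuc_conv intro!: bexI[of _ "Suc u"])
  qed
qed

lemma moves_stacked:
  assumes "n \<ge> 2" "length B + 1 < k + t div n" "finite D" "D \<subseteq> S"
  shows "(jmove n)\<^sup>*\<^sup>* (stacked n k (B @ [S]) t) (stacked n k (B @ [S - D]) (t + card D))"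
  using assms(3,4)
proof (induction rule: finite_induct)
  case (insert j D)
  have "length B + 1 < k + (t + card D) div n"
    using assms(2) div_le_mono[of t "t + card D" n] by linarith
  then have "jmove n (stacked n k (B @ [S - D]) (t + card D)) (stacked n k (B @ [S - D - {j}]) (Suc (t + card D)))"
    using insert assms(1) by (intro jmove_stacked) auto
  moreover have "S - insert j D = S - D - {j}" by blast
  ultimately show ?case using insert by (simp add: rtranclp.rtrancl_into_rtrancl)
qed simp

lemma thin_level:
  assumes "n \<ge> 2" "length B + 1 < k + t div n" "2 * r \<le> n + 1"
  shows "(jmove n)\<^sup>*\<^sup>* (stacked n k B t) (stacked n k (B @ [odds r]) (t + (n - r)))"
proof -
  have sub: "odds r \<subseteq> {1..n}" using assms(3) by (rule odds_subset)
  then have "{1..n} - ({1..n} - odds r) = odds r" "card ({1..n} - odds r) = n - r"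
    by (auto simp: card_Diff_subset finite_subset)
  then show ?thesis
    using moves_stacked[OF assms(1,2), of "{1..n} - odds r" "{1..n}"] assms(2)
    by (simp add: stacked_full)
qed

text \<open>All levels from the second on carry every other slot; the bottom level absorbs the remainder
of n(k - 2) modulo the number of these slots.\<close>

lemma optimal_reachable:
  assumes n: "n \<ge> 2" and R: "R = (n + 1) div 2" and s: "s \<le> R" "n * k = s + c * R + 2 * n" "k \<ge> 2"
    and "l \<le> c + 1"
  shows "(jmove n)\<^sup>*\<^sup>* (initial_config n k) (stacked n k (odds s # replicate l (odds R)) (n - s + l * (n - R)))"
  using \<open>l \<le> c + 1\<close>
proof (induction l)
  case 0
  have "initial_config n k = stacked n k [] 0"
    by (simp add: initial_config_def stacked_def)
  then show ?case
    using thin_level[of n "[]" k 0 s] s n R by simp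
next
  case (Suc l)
  define t where "t = n - s + l * (n - R)"
  have le: "R \<le> n" "s \<le> n" using R s by auto
  \<comment> \<open>Every move fills a fresh slot, so \<open>n * k + t\<close> slots have been
    filled at some time. The level to be thinned needs a full one above it, hence
    \<open>l + 3\<close> levels; \<open>l \<le> c\<close> provides them.\<close>
  have "int (n * (l + 3)) \<le> int (n * k + t)"
  proof -
    have "int t = int n - int s + int l * (int n - int R)"
      using le by (simp add: t_def of_nat_diff)
    moreover have "int l * int R \<le> int c * int R"
      using Suc.prems by (intro mult_right_mono) auto
    moreover have "int (n * k) = int s + int c * int R + 2 * int n"
      using s(2) by (metis of_nat_add of_nat_mult of_nat_numeral)
    ultimately show ?thesis by (simp add: algebra_simps)
  qed
  then have "n * (l + 3) \<le> n * k + t" by (simp only: of_nat_le_iff)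
  then have "l + 3 \<le> (n * k + t) div n"
    using n by (metis div_le_mono nonzero_mult_div_cancel_left not_numeral_le_zero)
  then have "length (odds s # replicate l (odds R)) + 1 < k + t div n"
    using n by (simp add: mult.commute)
  from thin_level[OF n this, of R] R
  have "(jmove n)\<^sup>*\<^sup>* (stacked n k (odds s # replicate l (odds R)) t)
     (stacked n k (odds s # replicate (Suc l) (odds R)) (t + (n - R)))"
    by (simp add: replicate_append_same)
  moreover have "n - s + Suc l * (n - R) = t + (n - R)"
    by (simp add: t_def)
  ultimately show ?case
    using Suc by (simp only: t_def) (rule rtranclp_trans, auto)
qed

lemma optimal_exists:
  assumes n: "n \<ge> 2" and k: "k \<ge> 3"
  shows "\<exists>Q. jenga_like n k Q \<and> genus n Q = gmax n k"
proof -
  define R where "R = (n + 1) div 2"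
  \<comment> \<open>Division shifted by one writes \<open>n * (k - 2)\<close> as
    \<open>s + c * R\<close> with \<open>1 \<le> s \<le> R\<close>; a remainder 0 would empty the
    bottom level.\<close>
  define c where "c = (n * (k - 2) - 1) div R"
  define s where "s = (n * (k - 2) - 1) mod R + 1"
  have R: "R \<ge> 1" "R < n" "2 * R \<le> n + 1" using n by (auto simp: R_def)
  have "n * (k - 2) \<ge> 1" using n k by simp
  then have sc: "n * (k - 2) = s + c * R"
    using div_mult_mod_eq[of "n * (k - 2) - 1" R] unfolding c_def s_def by linarith
  have s: "1 \<le> s" "s \<le> R" using R mod_less_divisor[of R "n * (k - 2) - 1"] by (auto simp: s_def simp del: mod_less_divisor)
  have nk: "n * k = s + c * R + 2 * n"
  proof -
    have "k = (k - 2) + 2" using k by simp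
    then have "n * k = n * (k - 2) + 2 * n" by (metis add_mult_distrib2 mult.commute)
    then show ?thesis using sc by simp
  qed
  define t where "t = n - s + (c + 1) * (n - R)"
  \<comment> \<open>The last thinned level serves only as an upper neighbour. Its \<open>R\<close>
    blocks, the full level and the \<open>n - R\<close> blocks on top are the \<open>2 * n\<close>
    blocks that do not count.\<close>
  define Q where "Q = odds s # replicate (c + 1) (odds R) @ [{1..n}, {1..n - R}]"
  have "n * k + t = (c + 3) * n + (n - R)"
  proof -
    have "s \<le> n" "R \<le> n" using R s by auto
    then have "int t = int n - int s + (int c + 1) * (int n - int R)"
      by (simp only: t_def of_nat_diff of_nat_add of_nat_mult of_nat_1)
    moreover have "int (n * k) = int s + int c * int R + 2 * int n"
      using nk by (metis of_nat_add of_nat_mult of_nat_numeral)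
    ultimately have "int (n * k + t) = int ((c + 3) * n + (n - R))"
      using R by (simp add: algebra_simps of_nat_diff)
    then show ?thesis by (simp only: of_nat_eq_iff)
  qed
  moreover have "(n * k + t) div n = k + t div n" "(n * k + t) mod n = t mod n"
    using n by (simp_all add: mult.commute)
  moreover have "((c + 3) * n + r) div n = c + 3 \<and> ((c + 3) * n + r) mod n = r" if "r < n" for r
    using that by simp
  from this[of "n - R"] have "((c + 3) * n + (n - R)) div n = c + 3" "((c + 3) * n + (n - R)) mod n = n - R"
    using R n by auto
  ultimately have "k + t div n = c + 3" "t mod n = n - R" by simp_all
  then have "stacked n k (odds s # replicate (c + 1) (odds R)) t = Q"
    using R by (simp add: stacked_def Q_def)
  then have "(jmove n)\<^sup>*\<^sup>* (initial_config n k) Q"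
    using optimal_reachable[OF n R_def s(2) nk, of "c + 1"] k by (simp add: t_def)
  moreover have "S \<noteq> {} \<and> S \<subseteq> {1..n}" if "S \<in> set Q" for S
  proof -
    have "odds s \<noteq> {}" "odds R \<noteq> {}" using s R by (auto simp: odds_def lessThan_empty_iff)
    moreover have "odds s \<subseteq> {1..n}" "odds R \<subseteq> {1..n}" using s R by (intro odds_subset; linarith)+
    ultimately show ?thesis using that R by (auto simp: Q_def split: if_splits)
  qed
  ultimately have Q: "jenga_like n k Q" "valid n Q"
    unfolding jenga_like_def valid_def by auto
  have upper: "Q ! Suc i = odds R" if "i < Suc c" for i
    using that unfolding Q_def nth_Cons_Suc nth_append by (simp del: replicate.simps)
  have "genus n Q = (\<Sum>i<c + 2 - 1. lruns Q i * (lruns Q (Suc i) - 1))"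
    using Q(2) n by (intro genus_full_below_top) (auto simp: Q_def nth_append)
  also have "\<dots> = (\<Sum>i<Suc c. lruns Q i * (int R - 1))"
  proof (rule sum.cong)
    fix i assume "i \<in> {..<Suc c}"
    then have "Q ! Suc i = odds R" by (simp add: upper)
    then show "lruns Q i * (lruns Q (Suc i) - 1) = lruns Q i * (int R - 1)" by (simp add: lruns_odds)
  qed simp
  also have "\<dots> = (int R - 1) * (\<Sum>i<Suc c. lruns Q i)"
    by (simp only: sum_distrib_left mult.commute)
  also have "(\<Sum>i<Suc c. lruns Q i) = lruns Q 0 + (\<Sum>i<c. lruns Q (Suc i))"
    by (rule sum.lessThan_Suc_shift)
  also have "lruns Q 0 = int s" by (rule lruns_odds) (simp add: Q_def)
  also have "(\<Sum>i<c. lruns Q (Suc i)) = (\<Sum>i<c. int R)"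
    by (intro sum.cong lruns_odds upper) auto
  finally have "genus n Q = gmax n k"
    using k sc by (simp add: gmax_eq R_def)
  with Q show ?thesis by blast
qed

theorem mainTheorem1:
  fixes n k :: nat
  assumes "n \<ge> 2" and "k \<ge> 2"
  shows "(\<forall>Q. jenga_like n k Q \<longrightarrow> genus n Q \<le> gmax n k) \<and>
         (\<exists>Q. jenga_like n k Q \<and> genus n Q = gmax n k)"
proof (intro conjI allI impI)
  fix Q assume "jenga_like n k Q"
  then show "genus n Q \<le> gmax n k" using assms by (intro genus_le_gmax)
next
  show "\<exists>Q. jenga_like n k Q \<and> genus n Q = gmax n k"
  \<comment> \<open>For \<open>k = 2\<close> there is no decomposition with
    \<open>s \<ge> 1\<close>, but the bound is 0 and the initial tower attains it.\<close>
  proof (cases "k = 2")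
    case True
    let ?Q = "initial_config n 2"
    have Q: "?Q = [{1..n}, {1..n}]" by (simp add: initial_config_def numeral_2_eq_2)
    have "valid n ?Q" by (auto simp: Q valid_def less_Suc_eq)
    then have "genus n ?Q = 0"
      using genus_full_below_top[of n ?Q 0] assms by (simp add: Q)
    moreover have "jenga_like n 2 ?Q" using assms by (auto simp: jenga_like_def Q less_Suc_eq)
    ultimately show ?thesis using True by (auto simp: gmax_eq)
  next
    case False
    then show ?thesis using assms by (intro optimal_exists) auto
  qed
qed

end
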